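(* Let $M=\{1,2\}$ be the two-element monoid with neutral element $1$ and $2\cdot 2=2$, and let $G=\{1,2\}$ be the two-element group with neutral element $1$ and $2\cdot 2=1$. Let $\rho_0,\rho_1,\varphi_0,\varphi_1,\gamma_0,\gamma_1\colon\{1,2\}\times\{1,2\}\to\{1,2\}$ be the maps given by the following matrices, where the value at $(i,j)$ is the entry in row $i$ and column $j$: $$\rho_0=\begin{pmatrix}1&1\\2&2\end{pmatrix},\ \rho_1=\begin{pmatrix}1&1\\2&1\end{pmatrix},\ \varphi_0=\begin{pmatrix}1&2\\1&2\end{pmatrix},\ \varphi_1=\begin{pmatrix}1&2\\1&1\end{pmatrix},\ \gamma_0=\begin{pmatrix}1&1\\1&1\end{pmatrix},\ \gamma_1=\begin{pmatrix}1&1\\1&2\end{pmatrix}.$$ The pointed monoid action systems $(X,B,\rho,\varphi,\gamma)$ with $X,B\in\{M,G\}$ are exactly the following 14: (1) $(G,G,\rho_0,\varphi_0,\gamma_0)$; (2) $(G,G,\rho_0,\varphi_0,\gamma_1)$; (3) $(G,M,\rho_0,\varphi_0,\gamma_0)$; (4) $(G,M,\rho_0,\varphi_0,\gamma_1)$; (5) $(G,M,\rho_0,\varphi_1,\gamma_0)$; (6) $(G,M,\rho_1,\varphi_1,\gamma_0)$; (7) $(M,G,\rho_0,\varphi_0,\gamma_0)$; (8) $(M,G,\rho_0,\varphi_0,\gamma_1)$; (9) $(M,G,\rho_1,\varphi_1,\gamma_1)$; (10) $(M,M,\rho_0,\varphi_0,\gamma_0)$; (11) $(M,M,\rho_0,\varphi_0,\gamma_1)$;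 (12) $(M,M,\rho_0,\varphi_1,\gamma_0)$; (13) $(M,M,\rho_0,\varphi_1,\gamma_1)$; (14) $(M,M,\rho_1,\varphi_1,\gamma_0)$. Moreover, sending a pointed semibiproduct $(X,A,B,p,k,q,s)$ to the system $(X,B,\rho,\varphi,\gamma)$ with $\rho(x,b)=q(k(x)s(b))$, $\varphi(b,x)=q(s(b)k(x))$, $\gamma(b,b')=q(s(b)s(b'))$ induces a bijection between isomorphism classes of pointed semibiproducts of monoids in which $X$ and $B$ both have two elements and these 14 systems; so there are exactly 14 such isomorphism classes (when an arbitrary two-element monoid is identified with $M$ or $G$ via the unique isomorphism).
   Context: Here monoids are written multiplicatively with neutral element $1$; "pointed" maps preserve the neutral element. A pointed semibiproduct of monoids is a tuple $(X,A,B,p,k,q,s)$ in which $X,A,B$ are monoids, $p\colon A\to B$ and $k\colon X\to A$ are monoid homomorphisms, $q\colon A\to X$ and $s\colon B\to A$ are maps preserving the neutral element (not necessarily homomorphisms), and: $ps=1_B$; $qk=1_X$; $kq(a)\cdot sp(a)=a$ for all $a\in A$; $pk$ is constant equal to the neutral element of $B$; $qs$ is constant equal to the neutral element of $X$. An isomorphism between $(X,A,B,p,k,q,s)$ and $(X',A',B',p',k',q',s')$ is a triple $(f_1,f_2,f_3)$ of monoid isomorphisms $f_1\colon X\to X'$, $f_2\colon A\to A'$, $f_3\colon B\to B'$ such that $f_2k=k'f_1$, $p'f_2=f_3p$, $f_2s=s'f_3$, $q'f_2=f_1q$. A pointed monoid action system is a tuple $(X,B,\rho,\varphi,\gamma)$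 in which $X$ and $B$ are monoids and $\rho\colon X\times B\to X$, $\varphi\colon B\times X\to X$, $\gamma\colon B\times B\to X$ are maps such that for all $x\in X$, $b,b'\in B$: $\rho(x,1)=x$, $\rho(1,b)=1$; $\varphi(1,x)=x$, $\varphi(b,1)=1$; $\gamma(b,1)=1=\gamma(1,b)$; $\rho(x,b)=\rho(\rho(x,b),b)$; $\varphi(b,x)=\rho(\varphi(b,x),b)$; $\gamma(b,b')=\rho(\gamma(b,b'),bb')$; and for all $x,x',x''\in X$, $b,b',b''\in B$, with $b'''=bb'b''$, $$\rho\big(\rho(x\,\varphi(b,x')\,\gamma(b,b'),bb')\,\varphi(bb',x'')\,\gamma(bb',b''),\,b'''\big)=\rho\big(x\,\varphi(b,\rho(x'\,\varphi(b',x'')\,\gamma(b',b''),b'b''))\,\gamma(b,b'b''),\,b'''\big).$$ *)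

theory Defs
  imports "HOL-Algebra.Group"
begin

section \<open>Monoid homomorphisms and isomorphisms\<close>

text \<open>The library's \<open>hom\<close> only asks for compatibility with multiplication.\<close>

definition monoid_hom :: "'a monoid \<Rightarrow> 'b monoid \<Rightarrow> ('a \<Rightarrow> 'b) set" where
  "monoid_hom A B = {f \<in> hom A B. f \<one>\<^bsub>A\<^esub> = \<one>\<^bsub>B\<^esub>}"

definition monoid_iso :: "'a monoid \<Rightarrow> 'b monoid \<Rightarrow> ('a \<Rightarrow> 'b) set" where
  "monoid_iso A B = {f \<in> monoid_hom A B. bij_betw f (carrier A) (carrier B)}"

definition pointed_map :: "'a monoid \<Rightarrow> 'b monoid \<Rightarrow> ('a \<Rightarrow> 'b) set" where
  "pointed_map A B = {f \<in> carrier A \<rightarrow> carrier B. f \<one>\<^bsub>A\<^esub> = \<one>\<^bsub>B\<^esub>}"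

section \<open>Pointed semibiproducts of monoids\<close>

locale pointed_semibiproduct = X: monoid X + A: monoid A + B: monoid B
  for X :: "'x monoid" and A :: "'a monoid" and B :: "'b monoid" +
  fixes p :: "'a \<Rightarrow> 'b" and k :: "'x \<Rightarrow> 'a" and q :: "'a \<Rightarrow> 'x" and s :: "'b \<Rightarrow> 'a"
  assumes p_hom: "p \<in> monoid_hom A B"
    and k_hom: "k \<in> monoid_hom X A"
    and q_pointed: "q \<in> pointed_map A X"
    and s_pointed: "s \<in> pointed_map B A"
    and ps: "\<And>b. b \<in> carrier B \<Longrightarrow> p (s b) = b"
    and qk: "\<And>x. x \<in> carrier X \<Longrightarrow> q (k x) = x"
    and decomp: "\<And>a. a \<in> carrier A \<Longrightarrow> k (q a) \<otimes>\<^bsub>A\<^esub> s (p a) = a"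
    and pk: "\<And>x. x \<in> carrier X \<Longrightarrow> p (k x) = \<one>\<^bsub>B\<^esub>"
    and qs: "\<And>b. b \<in> carrier B \<Longrightarrow> q (s b) = \<one>\<^bsub>X\<^esub>"

type_synonym ('x, 'a, 'b) semibiproduct_data =
  "'x monoid \<times> 'a monoid \<times> 'b monoid \<times> ('a \<Rightarrow> 'b) \<times> ('x \<Rightarrow> 'a) \<times> ('a \<Rightarrow> 'x) \<times> ('b \<Rightarrow> 'a)"

text \<open>The pointed semibiproducts in which \<open>X\<close> and \<open>B\<close> have two elements.\<close>

definition two_element_semibiproducts :: "('x, 'a, 'b) semibiproduct_data set" where
  "two_element_semibiproducts =
    {(X, A, B, p, k, q, s). pointed_semibiproduct X A B p k q s
       \<and> card (carrier X) = 2 \<and> card (carrier B) = 2}"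

text \<open>The equations are only required on the carriers, so that values of the maps
  outside the carriers are irrelevant up to isomorphism.\<close>

fun semibiproduct_isomorphic ::
  "('x, 'a, 'b) semibiproduct_data \<Rightarrow> ('y, 'c, 'd) semibiproduct_data \<Rightarrow> bool" where
  "semibiproduct_isomorphic (X, A, B, p, k, q, s) (X', A', B', p', k', q', s') \<longleftrightarrow>
    (\<exists>f1 f2 f3. f1 \<in> monoid_iso X X' \<and> f2 \<in> monoid_iso A A' \<and> f3 \<in> monoid_iso B B'
      \<and> (\<forall>x \<in> carrier X. f2 (k x) = k' (f1 x))
      \<and> (\<forall>a \<in> carrier A. p' (f2 a) = f3 (p a))
      \<and> (\<forall>b \<in> carrier B. f2 (s b) = s' (f3 b))
      \<and> (\<forall>a \<in> carrier A. q' (f2 a) = f1 (q a)))"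

definition semibiproduct_iso_rel ::
  "(('x, 'a, 'b) semibiproduct_data \<times> ('x, 'a, 'b) semibiproduct_data) set" where
  "semibiproduct_iso_rel =
    {(S, S'). S \<in> two_element_semibiproducts \<and> S' \<in> two_element_semibiproducts
       \<and> semibiproduct_isomorphic S S'}"

section \<open>Pointed monoid action systems\<close>

locale pointed_monoid_action_system = X: monoid X + B: monoid B
  for X :: "'x monoid" and B :: "'b monoid" +
  fixes \<rho> :: "'x \<Rightarrow> 'b \<Rightarrow> 'x" and \<phi> :: "'b \<Rightarrow> 'x \<Rightarrow> 'x" and \<gamma> :: "'b \<Rightarrow> 'b \<Rightarrow> 'x"
  assumes rho_closed: "\<rho> \<in> carrier X \<rightarrow> carrier B \<rightarrow> carrier X"
    and phi_closed: "\<phi> \<in> carrier B \<rightarrow> carrier X \<rightarrow> carrier X"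
    and gamma_closed: "\<gamma> \<in> carrier B \<rightarrow> carrier B \<rightarrow> carrier X"
    and rho_one_right: "\<And>x. x \<in> carrier X \<Longrightarrow> \<rho> x \<one>\<^bsub>B\<^esub> = x"
    and rho_one_left: "\<And>b. b \<in> carrier B \<Longrightarrow> \<rho> \<one>\<^bsub>X\<^esub> b = \<one>\<^bsub>X\<^esub>"
    and phi_one_left: "\<And>x. x \<in> carrier X \<Longrightarrow> \<phi> \<one>\<^bsub>B\<^esub> x = x"
    and phi_one_right: "\<And>b. b \<in> carrier B \<Longrightarrow> \<phi> b \<one>\<^bsub>X\<^esub> = \<one>\<^bsub>X\<^esub>"
    and gamma_one_right: "\<And>b. b \<in> carrier B \<Longrightarrow> \<gamma> b \<one>\<^bsub>B\<^esub> = \<one>\<^bsub>X\<^esub>"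
    and gamma_one_left: "\<And>b. b \<in> carrier B \<Longrightarrow> \<gamma> \<one>\<^bsub>B\<^esub> b = \<one>\<^bsub>X\<^esub>"
    and rho_rho: "\<And>x b. \<lbrakk>x \<in> carrier X; b \<in> carrier B\<rbrakk> \<Longrightarrow> \<rho> x b = \<rho> (\<rho> x b) b"
    and phi_rho: "\<And>x b. \<lbrakk>x \<in> carrier X; b \<in> carrier B\<rbrakk> \<Longrightarrow> \<phi> b x = \<rho> (\<phi> b x) b"
    and gamma_rho: "\<And>b b'. \<lbrakk>b \<in> carrier B; b' \<in> carrier B\<rbrakk>
      \<Longrightarrow> \<gamma> b b' = \<rho> (\<gamma> b b') (b \<otimes>\<^bsub>B\<^esub> b')"
    and main_identity: "\<And>x x' x'' b b' b'' b'''.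
      \<lbrakk>x \<in> carrier X; x' \<in> carrier X; x'' \<in> carrier X;
       b \<in> carrier B; b' \<in> carrier B; b'' \<in> carrier B;
       b''' = b \<otimes>\<^bsub>B\<^esub> b' \<otimes>\<^bsub>B\<^esub> b''\<rbrakk> \<Longrightarrow>
      \<rho> (\<rho> (x \<otimes>\<^bsub>X\<^esub> \<phi> b x' \<otimes>\<^bsub>X\<^esub> \<gamma> b b') (b \<otimes>\<^bsub>B\<^esub> b')
          \<otimes>\<^bsub>X\<^esub> \<phi> (b \<otimes>\<^bsub>B\<^esub> b') x'' \<otimes>\<^bsub>X\<^esub> \<gamma> (b \<otimes>\<^bsub>B\<^esub> b') b'') b'''
      = \<rho> (x \<otimes>\<^bsub>X\<^esub> \<phi> b (\<rho> (x' \<otimes>\<^bsub>X\<^esub> \<phi> b' x'' \<otimes>\<^bsub>X\<^esub> \<gamma> b' b'') (b' \<otimes>\<^bsub>B\<^esub> b''))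
          \<otimes>\<^bsub>X\<^esub> \<gamma> b (b' \<otimes>\<^bsub>B\<^esub> b'')) b'''"

type_synonym ('x, 'b) system_data =
  "'x monoid \<times> 'b monoid \<times> ('x \<Rightarrow> 'b \<Rightarrow> 'x) \<times> ('b \<Rightarrow> 'x \<Rightarrow> 'x) \<times> ('b \<Rightarrow> 'b \<Rightarrow> 'x)"

fun system_of :: "('x, 'a, 'b) semibiproduct_data \<Rightarrow> ('x, 'b) system_data" where
  "system_of (X, A, B, p, k, q, s) =
    (X, B, (\<lambda>x b. q (k x \<otimes>\<^bsub>A\<^esub> s b)), (\<lambda>b x. q (s b \<otimes>\<^bsub>A\<^esub> k x)),
     (\<lambda>b b'. q (s b \<otimes>\<^bsub>A\<^esub> s b')))"

section \<open>The two-element monoids and the fourteen systems\<close>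

text \<open>The carriers of both monoids are the whole type, so that maps on them are
  determined by their values on the carrier and can be compared by plain equality.\<close>

datatype two = E1 | E2

fun matrix22 :: "'c \<Rightarrow> 'c \<Rightarrow> 'c \<Rightarrow> 'c \<Rightarrow> two \<Rightarrow> two \<Rightarrow> 'c" where
  "matrix22 c11 c12 c21 c22 E1 E1 = c11"
| "matrix22 c11 c12 c21 c22 E1 E2 = c12"
| "matrix22 c11 c12 c21 c22 E2 E1 = c21"
| "matrix22 c11 c12 c21 c22 E2 E2 = c22"

definition monM :: "two monoid" where
  "monM = \<lparr>carrier = UNIV, mult = matrix22 E1 E2 E2 E2, one = E1\<rparr>"

definition grpG :: "two monoid" where
  "grpG = \<lparr>carrier = UNIV, mult = matrix22 E1 E2 E2 E1, one = E1\<rparr>"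

definition rho0 :: "two \<Rightarrow> two \<Rightarrow> two" where
  "rho0 = matrix22 E1 E1
                   E2 E2"

definition rho1 :: "two \<Rightarrow> two \<Rightarrow> two" where
  "rho1 = matrix22 E1 E1
                   E2 E1"

definition phi0 :: "two \<Rightarrow> two \<Rightarrow> two" where
  "phi0 = matrix22 E1 E2
                   E1 E2"

definition phi1 :: "two \<Rightarrow> two \<Rightarrow> two" where
  "phi1 = matrix22 E1 E2
                   E1 E1"

definition gamma0 :: "two \<Rightarrow> two \<Rightarrow> two" where
  "gamma0 = matrix22 E1 E1
                     E1 E1"

definition gamma1 :: "two \<Rightarrow> two \<Rightarrow> two" where
  "gamma1 = matrix22 E1 E1
                     E1 E2"

definition fourteen_systems :: "(two, two) system_data set" where
  "fourteen_systems =
    {(grpG, grpG, rho0, phi0, gamma0),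
     (grpG, grpG, rho0, phi0, gamma1),
     (grpG, monM, rho0, phi0, gamma0),
     (grpG, monM, rho0, phi0, gamma1),
     (grpG, monM, rho0, phi1, gamma0),
     (grpG, monM, rho1, phi1, gamma0),
     (monM, grpG, rho0, phi0, gamma0),
     (monM, grpG, rho0, phi0, gamma1),
     (monM, grpG, rho1, phi1, gamma1),
     (monM, monM, rho0, phi0, gamma0),
     (monM, monM, rho0, phi0, gamma1),
     (monM, monM, rho0, phi1, gamma0),
     (monM, monM, rho0, phi1, gamma1),
     (monM, monM, rho1, phi1, gamma0)}"

section \<open>Identifying an arbitrary two-element monoid with \<open>M\<close> or \<open>G\<close>\<close>

definition identifications :: "'x monoid \<Rightarrow> (two monoid \<times> (two \<Rightarrow> 'x)) set" where
  "identifications X = {(N, u). N \<in> {monM, grpG} \<and> u \<in> monoid_iso N X}"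

text \<open>Meaningful for two-element monoids, which have exactly one identification.\<close>

definition identification :: "'x monoid \<Rightarrow> two monoid \<times> (two \<Rightarrow> 'x)" where
  "identification X = (THE Nu. Nu \<in> identifications X)"

fun transport_system :: "('x, 'b) system_data \<Rightarrow> (two, two) system_data" where
  "transport_system (X, B, \<rho>, \<phi>, \<gamma>) =
    (let (N, u) = identification X; (P, v) = identification B in
      (N, P, (\<lambda>i j. inv_into UNIV u (\<rho> (u i) (v j))), (\<lambda>i j. inv_into UNIV u (\<phi> (v i) (u j))),
       (\<lambda>i j. inv_into UNIV u (\<gamma> (v i) (v j)))))"

definition classifying_system :: "('x, 'a, 'b) semibiproduct_data \<Rightarrow> (two, two) system_data" where
  "classifying_system S = transport_system (system_of S)"

end

theory Submission
  imports Defs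
begin

text \<open>
  In a semibiproduct an element \<open>a\<close> is determined by the pair \<open>(q a, p a)\<close>, and the pairs that occur
  are those with \<open>\<rho> x b = x\<close>. From \<open>k (\<rho> x b) s b = k x s b\<close>, \<open>k (\<phi> b x) s b = s b k x\<close> and
  \<open>k (\<gamma> b b') s (b b') = s b s b'\<close> one gets
  \<open>q (k x s b k x' s b') = \<rho> (x \<phi>(b, x') \<gamma>(b, b')) (b b')\<close>, so the multiplication of \<open>A\<close> is recovered
  from the system, and the last axiom of a system is associativity. Conversely this formula makes
  the fixed pairs of any system into a monoid. Hence isomorphism classes over fixed \<open>X\<close> and \<open>B\<close>
  correspond to systems. Since \<open>M\<close> and \<open>G\<close> have no nontrivial automorphisms, nothing is
  identified further. The unit laws leave only the value at \<open>(2, 2)\<close> of each of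
  \<open>\<rho>\<close>, \<open>\<phi>\<close>, \<open>\<gamma>\<close> open, so 32 candidates have to be tested.
\<close>

section \<open>The systems on the two-element monoids\<close>

lemma all_two: "(\<forall>i. P i) \<longleftrightarrow> P E1 \<and> P E2"
  by (metis two.exhaust)

lemma UNIV_two: "UNIV = {E1, E2}"
  using two.exhaust by auto

lemma fun2_two_eq_iff:
  "f = g \<longleftrightarrow> f E1 E1 = g E1 E1 \<and> f E1 E2 = g E1 E2 \<and> f E2 E1 = g E2 E1 \<and> f E2 E2 = g E2 E2"
  by (simp add: fun_eq_iff all_two)

lemma standard_monoid_simps [simp]:
  "carrier monM = UNIV" "carrier grpG = UNIV"
  "\<one>\<^bsub>monM\<^esub> = E1" "\<one>\<^bsub>grpG\<^esub> = E1"
  "mult monM = matrix22 E1 E2 E2 E2" "mult grpG = matrix22 E1 E2 E2 E1"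
  by (simp_all add: monM_def grpG_def)

lemma monM_neq_grpG: "monM \<noteq> grpG"
proof
  assume "monM = grpG"
  then have "mult monM E2 E2 = mult grpG E2 E2" by simp
  then show False by simp
qed

lemma monoid_standard: "N \<in> {monM, grpG} \<Longrightarrow> monoid N"
proof -
  have "monoid monM" "monoid grpG"
    by (rule monoidI; metis (full_types) UNIV_I matrix22.simps standard_monoid_simps two.exhaust)+
  then show "N \<in> {monM, grpG} \<Longrightarrow> monoid N" by auto
qed

lemma carrier_standard: "N \<in> {monM, grpG} \<Longrightarrow> carrier N = UNIV"
  and one_standard: "N \<in> {monM, grpG} \<Longrightarrow> \<one>\<^bsub>N\<^esub> = E1"
  by auto

lemmas system_maps = rho0_def rho1_def phi0_def phi1_def gamma0_def gamma1_def

lemma system_maps_neq: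
  "rho0 \<noteq> rho1" "phi0 \<noteq> phi1" "gamma0 \<noteq> gamma1"
  by (simp_all add: fun2_two_eq_iff system_maps)

text \<open>The unit laws prescribe the first row and the first column of each matrix, so each map
  is determined by its entry at \<open>E2\<close>, \<open>E2\<close>.\<close>

lemma action_system_maps:
  assumes "X \<in> {monM, grpG}" "B \<in> {monM, grpG}" "pointed_monoid_action_system X B \<rho> \<phi> \<gamma>"
  shows "\<rho> \<in> {rho0, rho1}" "\<phi> \<in> {phi0, phi1}" "\<gamma> \<in> {gamma0, gamma1}"
proof -
  interpret pointed_monoid_action_system X B \<rho> \<phi> \<gamma> by fact
  note [simp] = carrier_standard[OF assms(1)] carrier_standard[OF assms(2)]
    one_standard[OF assms(1)] one_standard[OF assms(2)]
  have "\<rho> E2 E2 = E1 \<or> \<rho> E2 E2 = E2" using two.exhaust by blast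
  then show "\<rho> \<in> {rho0, rho1}"
    using rho_one_left rho_one_right by (auto simp: fun2_two_eq_iff system_maps)
  have "\<phi> E2 E2 = E1 \<or> \<phi> E2 E2 = E2" using two.exhaust by blast
  then show "\<phi> \<in> {phi0, phi1}"
    using phi_one_left phi_one_right by (auto simp: fun2_two_eq_iff system_maps)
  have "\<gamma> E2 E2 = E1 \<or> \<gamma> E2 E2 = E2" using two.exhaust by blast
  then show "\<gamma> \<in> {gamma0, gamma1}"
    using gamma_one_left gamma_one_right by (auto simp: fun2_two_eq_iff system_maps)
qed

text \<open>Both carriers are all of \<open>two\<close>, so the membership premises vanish. Each
  axiom becomes a plain quantification over \<open>two\<close>, which \<open>all_two\<close> expands
  into finitely many computations.\<close>

lemma action_system_standard_iff:
  assumes "X \<in> {monM, grpG}" "B \<in> {monM, grpG}"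
  shows "pointed_monoid_action_system X B \<rho> \<phi> \<gamma> \<longleftrightarrow>
    (\<forall>x. \<rho> x E1 = x) \<and> (\<forall>b. \<rho> E1 b = E1) \<and> (\<forall>x. \<phi> E1 x = x) \<and> (\<forall>b. \<phi> b E1 = E1)
    \<and> (\<forall>b. \<gamma> b E1 = E1) \<and> (\<forall>b. \<gamma> E1 b = E1) \<and> (\<forall>x b. \<rho> x b = \<rho> (\<rho> x b) b)
    \<and> (\<forall>x b. \<phi> b x = \<rho> (\<phi> b x) b) \<and> (\<forall>b b'. \<gamma> b b' = \<rho> (\<gamma> b b') (b \<otimes>\<^bsub>B\<^esub> b'))
    \<and> (\<forall>x x' x'' b b' b''.
      \<rho> (\<rho> (x \<otimes>\<^bsub>X\<^esub> \<phi> b x' \<otimes>\<^bsub>X\<^esub> \<gamma> b b') (b \<otimes>\<^bsub>B\<^esub> b')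
          \<otimes>\<^bsub>X\<^esub> \<phi> (b \<otimes>\<^bsub>B\<^esub> b') x'' \<otimes>\<^bsub>X\<^esub> \<gamma> (b \<otimes>\<^bsub>B\<^esub> b') b'') (b \<otimes>\<^bsub>B\<^esub> b' \<otimes>\<^bsub>B\<^esub> b'')
      = \<rho> (x \<otimes>\<^bsub>X\<^esub> \<phi> b (\<rho> (x' \<otimes>\<^bsub>X\<^esub> \<phi> b' x'' \<otimes>\<^bsub>X\<^esub> \<gamma> b' b'') (b' \<otimes>\<^bsub>B\<^esub> b''))
          \<otimes>\<^bsub>X\<^esub> \<gamma> b (b' \<otimes>\<^bsub>B\<^esub> b'')) (b \<otimes>\<^bsub>B\<^esub> b' \<otimes>\<^bsub>B\<^esub> b''))"
  unfolding pointed_monoid_action_system_def pointed_monoid_action_system_axioms_def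
  using monoid_standard[OF assms(1)] monoid_standard[OF assms(2)]
  by (simp add: carrier_standard[OF assms(1)] carrier_standard[OF assms(2)]
      one_standard[OF assms(1)] one_standard[OF assms(2)])

lemma action_system_iff_mem_fourteen_systems:
  assumes "X \<in> {monM, grpG}" "B \<in> {monM, grpG}"
    "\<rho> \<in> {rho0, rho1}" "\<phi> \<in> {phi0, phi1}" "\<gamma> \<in> {gamma0, gamma1}"
  shows "pointed_monoid_action_system X B \<rho> \<phi> \<gamma> \<longleftrightarrow> (X, B, \<rho>, \<phi>, \<gamma>) \<in> fourteen_systems"
proof -
  \<comment> \<open>The fourteen tuples sorted by \<open>\<rho>\<close> and \<open>\<phi>\<close>:
    all eight with \<open>rho0\<close> and \<open>phi0\<close>, three with \<open>rho0\<close> and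
    \<open>phi1\<close>, three with \<open>rho1\<close> and \<open>phi1\<close>. The pair
    \<open>rho1\<close>, \<open>phi0\<close> does not occur, since it violates \<phi>(b, x) =
    \<rho>(\<phi>(b, x), b) at \<open>E2\<close>, \<open>E2\<close>.\<close>
  have mem: "(X, B, \<rho>, \<phi>, \<gamma>) \<in> fourteen_systems \<longleftrightarrow>
    (\<rho> = rho0 \<and> \<phi> = phi0) \<or> (\<rho> = rho0 \<and> \<phi> = phi1 \<and> B = monM \<and> (\<gamma> = gamma0 \<or> X = monM))
    \<or> (\<rho> = rho1 \<and> \<phi> = phi1 \<and> B = monM \<and> \<gamma> = gamma0)
    \<or> (\<rho> = rho1 \<and> \<phi> = phi1 \<and> X = monM \<and> B = grpG \<and> \<gamma> = gamma1)"
    using assms unfolding insert_iff empty_iff simp_thms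
    by (elim disjE; hypsubst)
      (simp_all add: fourteen_systems_def system_maps_neq system_maps_neq[symmetric]
        monM_neq_grpG monM_neq_grpG[symmetric])
  \<comment> \<open>In each of the 32 cases the equalities between named maps and monoids are
    decided first. Only then are the matrices unfolded and the axioms evaluated.\<close>
  show ?thesis
    unfolding mem action_system_standard_iff[OF assms(1,2)]
    using assms unfolding insert_iff empty_iff simp_thms
    by (elim disjE; hypsubst; simp only: system_maps_neq system_maps_neq[symmetric]
        monM_neq_grpG monM_neq_grpG[symmetric] simp_thms) (simp_all add: all_two system_maps)
qed

lemma action_systems_eq_fourteen_systems:
  "{(X, B, \<rho>, \<phi>, \<gamma>). X \<in> {monM, grpG} \<and> B \<in> {monM, grpG}
     \<and> pointed_monoid_action_system X B \<rho> \<phi> \<gamma>} = fourteen_systems"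
proof -
  have "X \<in> {monM, grpG} \<and> B \<in> {monM, grpG} \<and> \<rho> \<in> {rho0, rho1} \<and> \<phi> \<in> {phi0, phi1}
      \<and> \<gamma> \<in> {gamma0, gamma1}" if "(X, B, \<rho>, \<phi>, \<gamma>) \<in> fourteen_systems" for X B \<rho> \<phi> \<gamma>
    using that unfolding fourteen_systems_def by auto
  then have "(X, B, \<rho>, \<phi>, \<gamma>) \<in> fourteen_systems \<longleftrightarrow> X \<in> {monM, grpG} \<and> B \<in> {monM, grpG}
     \<and> pointed_monoid_action_system X B \<rho> \<phi> \<gamma>" for X B \<rho> \<phi> \<gamma>
    using action_system_maps[of X B \<rho> \<phi> \<gamma>] action_system_iff_mem_fourteen_systems[of X B \<rho> \<phi> \<gamma>]
    by metis
  then show ?thesis by (simp add: set_eq_iff split_paired_all)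
qed

lemma card_fourteen_systems: "card fourteen_systems = 14"
  by (simp add: fourteen_systems_def monM_neq_grpG monM_neq_grpG[symmetric]
      system_maps_neq system_maps_neq[symmetric])

section \<open>Isomorphisms of monoids and identifications\<close>

lemma monoid_homD:
  assumes "f \<in> monoid_hom A B"
  shows "\<And>a. a \<in> carrier A \<Longrightarrow> f a \<in> carrier B"
    and "\<And>a a'. \<lbrakk>a \<in> carrier A; a' \<in> carrier A\<rbrakk> \<Longrightarrow> f (a \<otimes>\<^bsub>A\<^esub> a') = f a \<otimes>\<^bsub>B\<^esub> f a'"
    and "f \<one>\<^bsub>A\<^esub> = \<one>\<^bsub>B\<^esub>"
  using assms by (auto simp: monoid_hom_def hom_def)

lemma monoid_homI:
  assumes "\<And>a. a \<in> carrier A \<Longrightarrow> f a \<in> carrier B"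
    and "\<And>a a'. \<lbrakk>a \<in> carrier A; a' \<in> carrier A\<rbrakk> \<Longrightarrow> f (a \<otimes>\<^bsub>A\<^esub> a') = f a \<otimes>\<^bsub>B\<^esub> f a'"
    and "f \<one>\<^bsub>A\<^esub> = \<one>\<^bsub>B\<^esub>"
  shows "f \<in> monoid_hom A B"
  using assms by (auto simp: monoid_hom_def hom_def)

lemma monoid_isoD:
  assumes "f \<in> monoid_iso A B"
  shows "f \<in> monoid_hom A B" "bij_betw f (carrier A) (carrier B)"
  using assms by (auto simp: monoid_iso_def)

lemma monoid_iso_id: "id \<in> monoid_iso A A"
  by (simp add: monoid_iso_def monoid_hom_def hom_def)

lemma monoid_iso_comp:
  assumes "f \<in> monoid_iso A B" "g \<in> monoid_iso B C"
  shows "g \<circ> f \<in> monoid_iso A C"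
  using assms bij_betw_trans[of f "carrier A" "carrier B" g "carrier C"]
  by (auto simp: monoid_iso_def monoid_hom_def hom_def Pi_iff)

lemma monoid_iso_inverse:
  assumes f: "f \<in> monoid_iso A B" and A: "monoid A"
  shows "inv_into (carrier A) f \<in> monoid_iso B A"
    and "\<And>a. a \<in> carrier A \<Longrightarrow> inv_into (carrier A) f (f a) = a"
    and "\<And>b. b \<in> carrier B \<Longrightarrow> f (inv_into (carrier A) f b) = b"
    and "\<And>b. b \<in> carrier B \<Longrightarrow> inv_into (carrier A) f b \<in> carrier A"
proof -
  let ?g = "inv_into (carrier A) f"
  interpret A: monoid A by fact
  note hom = monoid_homD[OF monoid_isoD(1)[OF f]]
  note bij = monoid_isoD(2)[OF f]
  show gf: "?g (f a) = a" if "a \<in> carrier A" for a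
    using bij that by (simp add: bij_betw_def)
  show fg: "f (?g b) = b" if "b \<in> carrier B" for b
    using bij that by (simp add: bij_betw_inv_into_right)
  show cl: "?g b \<in> carrier A" if "b \<in> carrier B" for b
    using bij that by (metis bij_betw_def inv_into_into)
  \<comment> \<open>The product of the two preimages is sent by \<open>f\<close> to the product of
    \<open>b\<close> and \<open>b'\<close>, so \<open>gf\<close> at that product gives the
    claim.\<close>
  have "?g (b \<otimes>\<^bsub>B\<^esub> b') = ?g b \<otimes>\<^bsub>A\<^esub> ?g b'" if "b \<in> carrier B" "b' \<in> carrier B" for b b'
    using gf[of "?g b \<otimes>\<^bsub>A\<^esub> ?g b'"] that by (simp add: hom(2) fg cl)
  moreover have "?g \<one>\<^bsub>B\<^esub> = \<one>\<^bsub>A\<^esub>"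
    using gf[of "\<one>\<^bsub>A\<^esub>"] hom(3) by simp
  ultimately show "?g \<in> monoid_iso B A"
    using cl bij by (auto simp: monoid_iso_def bij_betw_inv_into intro!: monoid_homI)
qed

text \<open>Besides the unit there is a single element \<open>a\<close>, and only its square is
  open: the value \<open>a\<close> gives \<open>monM\<close>, the unit gives
  \<open>grpG\<close>.\<close>

lemma two_element_monoid_has_identification:
  assumes X: "monoid X" and card: "card (carrier X) = 2"
  shows "\<exists>Nu. Nu \<in> identifications X"
proof -
  interpret X: monoid X by fact
  obtain a where a: "carrier X = {\<one>\<^bsub>X\<^esub>, a}" "a \<noteq> \<one>\<^bsub>X\<^esub>"
    using card X.one_closed unfolding card_2_iff by (metis insert_commute insert_iff singletonD)
  let ?u = "\<lambda>i. case i of E1 \<Rightarrow> \<one>\<^bsub>X\<^esub> | E2 \<Rightarrow> a"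
  have bij: "bij_betw ?u UNIV (carrier X)"
    using a by (auto simp: bij_betw_def inj_on_def UNIV_two)
  have aX: "a \<in> carrier X" using a by simp
  have "a \<otimes>\<^bsub>X\<^esub> a \<in> carrier X" using aX by simp
  then consider "a \<otimes>\<^bsub>X\<^esub> a = a" | "a \<otimes>\<^bsub>X\<^esub> a = \<one>\<^bsub>X\<^esub>" using a(1) by auto
  then show ?thesis
  proof cases
    case 1
    then have "?u \<in> monoid_iso monM X"
      using bij aX by (auto simp: monoid_iso_def intro!: monoid_homI split: two.splits)
    then show ?thesis by (auto simp: identifications_def)
  next
    case 2
    then have "?u \<in> monoid_iso grpG X"
      using bij aX by (auto simp: monoid_iso_def intro!: monoid_homI split: two.splits)
    then show ?thesis by (auto simp: identifications_def)
  qed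
qed

text \<open>Both bijections send \<open>E1\<close> to the unit, hence \<open>E2\<close> to the other
  element, so they agree. The square of \<open>E2\<close>, read off in \<open>X\<close>, is then the
  same in \<open>N\<close> and \<open>P\<close>, and this entry separates \<open>monM\<close> from
  \<open>grpG\<close>.\<close>

lemma identification_unique:
  assumes "(N, u) \<in> identifications X" "(P, v) \<in> identifications X"
  shows "N = P \<and> u = v"
proof -
  have std: "N \<in> {monM, grpG}" "P \<in> {monM, grpG}"
    and u: "u \<in> monoid_iso N X" and v: "v \<in> monoid_iso P X"
    using assms by (auto simp: identifications_def)
  note [simp] = carrier_standard[OF std(1)] carrier_standard[OF std(2)]
    one_standard[OF std(1)] one_standard[OF std(2)]
  note hu = monoid_homD[OF monoid_isoD(1)[OF u]] and hv = monoid_homD[OF monoid_isoD(1)[OF v]]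
  have ru: "inj u" "u ` UNIV = carrier X" and rv: "inj v" "v ` UNIV = carrier X"
    using monoid_isoD(2)[OF u] monoid_isoD(2)[OF v] by (auto simp: bij_betw_def)
  have E1: "u E1 = v E1" using hu(3) hv(3) by simp
  have "u E2 \<in> v ` UNIV" using ru rv by auto
  then have E2: "u E2 = v E2"
    using E1 ru(1) by (auto simp: UNIV_two inj_def)
  have eq: "u = v" using E1 E2 by (auto simp: fun_eq_iff all_two)
  have "u (E2 \<otimes>\<^bsub>N\<^esub> E2) = u (E2 \<otimes>\<^bsub>P\<^esub> E2)"
    using hu(2)[of E2 E2] hv(2)[of E2 E2] eq by simp
  then have "E2 \<otimes>\<^bsub>N\<^esub> E2 = E2 \<otimes>\<^bsub>P\<^esub> E2" using ru(1) by (simp add: inj_eq)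
  then have "N = P" using std by auto
  then show ?thesis using eq by simp
qed

lemma identification_eqI: "(N, u) \<in> identifications X \<Longrightarrow> identification X = (N, u)"
  unfolding identification_def by (rule the_equality) (auto dest: identification_unique)

lemma identification_standard: "N \<in> {monM, grpG} \<Longrightarrow> identification N = (N, id)"
  by (rule identification_eqI) (simp add: identifications_def monoid_iso_id)

text \<open>The last clause rests on uniqueness: \<open>u\<close> followed by an isomorphism
  identifies the target, so it is the chosen identification there. This makes systems comparable
  across isomorphic monoids.\<close>

lemma obtain_identification:
  assumes "monoid X" "card (carrier X) = 2"
  obtains N u where "N \<in> {monM, grpG}" "u \<in> monoid_iso N X" "identification X = (N, u)"
    "\<And>Y f. f \<in> monoid_iso X Y \<Longrightarrow> identification Y = (N, f \<circ> u)"
proof -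
  obtain N u where Nu: "(N, u) \<in> identifications X"
    using two_element_monoid_has_identification[OF assms] by auto
  have "(N, f \<circ> u) \<in> identifications Y" if "f \<in> monoid_iso X Y" for Y f
    using Nu that by (auto simp: identifications_def intro: monoid_iso_comp)
  then show thesis
    using that Nu identification_eqI by (metis (no_types, lifting) identifications_def mem_Collect_eq case_prodD)
qed

section \<open>Semibiproducts and their action systems\<close>

context pointed_semibiproduct
begin

lemma closed [simp, intro]:
  "a \<in> carrier A \<Longrightarrow> p a \<in> carrier B" "x \<in> carrier X \<Longrightarrow> k x \<in> carrier A"
  "a \<in> carrier A \<Longrightarrow> q a \<in> carrier X" "b \<in> carrier B \<Longrightarrow> s b \<in> carrier A"
  using p_hom k_hom q_pointed s_pointed by (auto simp: monoid_hom_def hom_def pointed_map_def)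

lemma maps_one [simp]:
  "p \<one>\<^bsub>A\<^esub> = \<one>\<^bsub>B\<^esub>" "k \<one>\<^bsub>X\<^esub> = \<one>\<^bsub>A\<^esub>" "q \<one>\<^bsub>A\<^esub> = \<one>\<^bsub>X\<^esub>" "s \<one>\<^bsub>B\<^esub> = \<one>\<^bsub>A\<^esub>"
  using p_hom k_hom q_pointed s_pointed by (auto simp: monoid_hom_def pointed_map_def)

lemmas p_mult = monoid_homD(2)[OF p_hom]
lemmas k_mult = monoid_homD(2)[OF k_hom]

text \<open>By \<open>decomp\<close>, \<open>a\<close> is rebuilt from \<open>q a\<close> and
  \<open>p a\<close>, so equations in \<open>A\<close> can be checked in these two
  coordinates.\<close>

lemma eq_iff_q_p:
  "\<lbrakk>a \<in> carrier A; a' \<in> carrier A\<rbrakk> \<Longrightarrow> a = a' \<longleftrightarrow> q a = q a' \<and> p a = p a'"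
  using decomp by metis

definition rho where "rho x b = q (k x \<otimes>\<^bsub>A\<^esub> s b)"
definition phi where "phi b x = q (s b \<otimes>\<^bsub>A\<^esub> k x)"
definition gam where "gam b b' = q (s b \<otimes>\<^bsub>A\<^esub> s b')"

lemma operations_closed [simp, intro]:
  "\<lbrakk>x \<in> carrier X; b \<in> carrier B\<rbrakk> \<Longrightarrow> rho x b \<in> carrier X"
  "\<lbrakk>x \<in> carrier X; b \<in> carrier B\<rbrakk> \<Longrightarrow> phi b x \<in> carrier X"
  "\<lbrakk>b \<in> carrier B; b' \<in> carrier B\<rbrakk> \<Longrightarrow> gam b b' \<in> carrier X"
  by (simp_all add: rho_def phi_def gam_def)

text \<open>The right-hand side has coordinates \<open>rho x b\<close> and \<open>b\<close>, so this
  is \<open>decomp\<close> for it. The next two lemmas are \<open>decomp\<close> for the product of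
  \<open>s b\<close> with \<open>k x\<close> and with \<open>s b'\<close>.\<close>

lemma k_rho_mult_s:
  "\<lbrakk>x \<in> carrier X; b \<in> carrier B\<rbrakk> \<Longrightarrow> k (rho x b) \<otimes>\<^bsub>A\<^esub> s b = k x \<otimes>\<^bsub>A\<^esub> s b"
  using decomp[of "k x \<otimes>\<^bsub>A\<^esub> s b"] by (simp add: rho_def p_mult pk ps)

lemma s_mult_k:
  "\<lbrakk>x \<in> carrier X; b \<in> carrier B\<rbrakk> \<Longrightarrow> k (phi b x) \<otimes>\<^bsub>A\<^esub> s b = s b \<otimes>\<^bsub>A\<^esub> k x"
  using decomp[of "s b \<otimes>\<^bsub>A\<^esub> k x"] by (simp add: phi_def p_mult pk ps)

lemma s_mult_s:
  "\<lbrakk>b \<in> carrier B; b' \<in> carrier B\<rbrakk>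
    \<Longrightarrow> k (gam b b') \<otimes>\<^bsub>A\<^esub> s (b \<otimes>\<^bsub>B\<^esub> b') = s b \<otimes>\<^bsub>A\<^esub> s b'"
  using decomp[of "s b \<otimes>\<^bsub>A\<^esub> s b'"] by (simp add: gam_def p_mult ps)

text \<open>\<open>s_mult_s\<close> splits the last factor into \<open>s b\<close> and
  \<open>s b'\<close>, then \<open>s_mult_k\<close> moves \<open>s b\<close> to the left past
  \<open>k x'\<close>. No \<open>rho\<close> appears because, by \<open>k_rho_mult_s\<close>, the
  factor \<open>s\<close> absorbs it.\<close>

lemma mult_formula:
  assumes "x \<in> carrier X" "x' \<in> carrier X" "b \<in> carrier B" "b' \<in> carrier B"
  shows "k (x \<otimes>\<^bsub>X\<^esub> phi b x' \<otimes>\<^bsub>X\<^esub> gam b b') \<otimes>\<^bsub>A\<^esub> s (b \<otimes>\<^bsub>B\<^esub> b')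
    = (k x \<otimes>\<^bsub>A\<^esub> s b) \<otimes>\<^bsub>A\<^esub> (k x' \<otimes>\<^bsub>A\<^esub> s b')"
proof -
  have "k (x \<otimes>\<^bsub>X\<^esub> phi b x' \<otimes>\<^bsub>X\<^esub> gam b b') \<otimes>\<^bsub>A\<^esub> s (b \<otimes>\<^bsub>B\<^esub> b')
    = k x \<otimes>\<^bsub>A\<^esub> k (phi b x') \<otimes>\<^bsub>A\<^esub> (k (gam b b') \<otimes>\<^bsub>A\<^esub> s (b \<otimes>\<^bsub>B\<^esub> b'))"
    using assms by (simp add: k_mult A.m_assoc)
  also have "\<dots> = k x \<otimes>\<^bsub>A\<^esub> (k (phi b x') \<otimes>\<^bsub>A\<^esub> s b) \<otimes>\<^bsub>A\<^esub> s b'"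
    using assms by (simp add: s_mult_s A.m_assoc)
  also have "\<dots> = (k x \<otimes>\<^bsub>A\<^esub> s b) \<otimes>\<^bsub>A\<^esub> (k x' \<otimes>\<^bsub>A\<^esub> s b')"
    using assms by (simp add: s_mult_k A.m_assoc)
  finally show ?thesis .
qed

text \<open>For the coordinates of \<open>a\<close> and \<open>a'\<close>, \<open>decomp\<close>
  turns the right-hand side of \<open>mult_formula\<close> into their product. Together with
  \<open>p_mult\<close> this expresses multiplication in coordinates.\<close>

lemma q_mult:
  assumes "a \<in> carrier A" "a' \<in> carrier A"
  shows "q (a \<otimes>\<^bsub>A\<^esub> a')
    = rho (q a \<otimes>\<^bsub>X\<^esub> phi (p a) (q a') \<otimes>\<^bsub>X\<^esub> gam (p a) (p a')) (p a \<otimes>\<^bsub>B\<^esub> p a')"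
  using mult_formula[of "q a" "q a'" "p a" "p a'"] assms by (simp add: rho_def decomp)

lemma rho_q_p: "a \<in> carrier A \<Longrightarrow> rho (q a) (p a) = q a"
  by (simp add: rho_def decomp)

text \<open>Both sides of the last axiom are \<open>q\<close> of one triple product, bracketed in
  two ways. The three laws before it arise by applying \<open>q\<close> to
  \<open>k_rho_mult_s\<close>, \<open>s_mult_k\<close> and \<open>s_mult_s\<close>.\<close>

lemma action_system: "pointed_monoid_action_system X B rho phi gam"
proof unfold_locales
  fix x b assume *: "x \<in> carrier X" "b \<in> carrier B"
  show "rho x b = rho (rho x b) b"
    using k_rho_mult_s[OF *] by (metis rho_def)
  show "phi b x = rho (phi b x) b"
    using s_mult_k[OF *] by (simp add: rho_def phi_def)
next
  fix b b' assume *: "b \<in> carrier B" "b' \<in> carrier B"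
  show "gam b b' = rho (gam b b') (b \<otimes>\<^bsub>B\<^esub> b')"
    using s_mult_s[OF *] by (simp add: rho_def gam_def)
next
  fix x x' x'' b b' b'' b'''
  assume x: "x \<in> carrier X" "x' \<in> carrier X" "x'' \<in> carrier X"
    and b: "b \<in> carrier B" "b' \<in> carrier B" "b'' \<in> carrier B"
    and b''': "b''' = b \<otimes>\<^bsub>B\<^esub> b' \<otimes>\<^bsub>B\<^esub> b''"
  let ?y = "x \<otimes>\<^bsub>X\<^esub> phi b x' \<otimes>\<^bsub>X\<^esub> gam b b'"
  let ?z = "x' \<otimes>\<^bsub>X\<^esub> phi b' x'' \<otimes>\<^bsub>X\<^esub> gam b' b''"
  have cl: "?y \<in> carrier X" "?z \<in> carrier X" using x b by auto
  have "rho (rho ?y (b \<otimes>\<^bsub>B\<^esub> b') \<otimes>\<^bsub>X\<^esub> phi (b \<otimes>\<^bsub>B\<^esub> b') x'' \<otimes>\<^bsub>X\<^esub> gam (b \<otimes>\<^bsub>B\<^esub> b') b'') b'''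
    = q ((k ?y \<otimes>\<^bsub>A\<^esub> s (b \<otimes>\<^bsub>B\<^esub> b')) \<otimes>\<^bsub>A\<^esub> (k x'' \<otimes>\<^bsub>A\<^esub> s b''))"
    unfolding b''' rho_def[of "_ \<otimes>\<^bsub>X\<^esub> _"]
    using mult_formula[of "rho ?y (b \<otimes>\<^bsub>B\<^esub> b')" x'' "b \<otimes>\<^bsub>B\<^esub> b'" b''] x b cl
    by (simp add: k_rho_mult_s rho_def[symmetric])
  \<comment> \<open>Splitting both inner products by \<open>mult_formula\<close> exposes the two
    bracketings of the triple product in \<open>A\<close>.\<close>
  also have "\<dots> = q ((k x \<otimes>\<^bsub>A\<^esub> s b) \<otimes>\<^bsub>A\<^esub> (k ?z \<otimes>\<^bsub>A\<^esub> s (b' \<otimes>\<^bsub>B\<^esub> b'')))"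
    using x b by (simp only: mult_formula) (simp add: A.m_assoc)
  also have "\<dots> = rho (x \<otimes>\<^bsub>X\<^esub> phi b (rho ?z (b' \<otimes>\<^bsub>B\<^esub> b'')) \<otimes>\<^bsub>X\<^esub> gam b (b' \<otimes>\<^bsub>B\<^esub> b'')) b'''"
    unfolding b''' using mult_formula[of x "rho ?z (b' \<otimes>\<^bsub>B\<^esub> b'')" b "b' \<otimes>\<^bsub>B\<^esub> b''"] x b cl
    by (simp add: k_rho_mult_s B.m_assoc rho_def[of "x \<otimes>\<^bsub>X\<^esub> _ \<otimes>\<^bsub>X\<^esub> _"])
  finally show "rho (rho ?y (b \<otimes>\<^bsub>B\<^esub> b') \<otimes>\<^bsub>X\<^esub> phi (b \<otimes>\<^bsub>B\<^esub> b') x'' \<otimes>\<^bsub>X\<^esub> gam (b \<otimes>\<^bsub>B\<^esub> b') b'') b'''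
    = rho (x \<otimes>\<^bsub>X\<^esub> phi b (rho ?z (b' \<otimes>\<^bsub>B\<^esub> b'')) \<otimes>\<^bsub>X\<^esub> gam b (b' \<otimes>\<^bsub>B\<^esub> b'')) b'''" .
qed (auto simp: rho_def phi_def gam_def qk qs)

lemma system_of_eq: "system_of (X, A, B, p, k, q, s) = (X, B, rho, phi, gam)"
  by (simp add: rho_def phi_def gam_def fun_eq_iff)

end

section \<open>Isomorphisms of semibiproducts\<close>

definition semibiproduct :: "('x, 'a, 'b) semibiproduct_data \<Rightarrow> bool" where
  "semibiproduct S = (case S of (X, A, B, p, k, q, s) \<Rightarrow> pointed_semibiproduct X A B p k q s)"

text \<open>The three tuples may live over different types, because the classification passes
  through tuples over \<open>two\<close>.\<close>

lemma semibiproduct_isomorphic_trans: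
  assumes "semibiproduct S" "semibiproduct_isomorphic S S'" "semibiproduct_isomorphic S' S''"
  shows "semibiproduct_isomorphic S S''"
proof -
  obtain X A B p k q s where S: "S = (X, A, B, p, k, q, s)" by (cases S)
  obtain X' A' B' p' k' q' s' where S': "S' = (X', A', B', p', k', q', s')" by (cases S')
  obtain X'' A'' B'' p'' k'' q'' s'' where S'': "S'' = (X'', A'', B'', p'', k'', q'', s'')"
    by (cases S'')
  obtain f1 f2 f3 where f: "f1 \<in> monoid_iso X X'" "f2 \<in> monoid_iso A A'" "f3 \<in> monoid_iso B B'"
    and fc: "\<forall>x\<in>carrier X. f2 (k x) = k' (f1 x)" "\<forall>a\<in>carrier A. p' (f2 a) = f3 (p a)"
      "\<forall>b\<in>carrier B. f2 (s b) = s' (f3 b)" "\<forall>a\<in>carrier A. q' (f2 a) = f1 (q a)"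
    using assms(2) unfolding S S' by auto
  obtain g1 g2 g3 where g: "g1 \<in> monoid_iso X' X''" "g2 \<in> monoid_iso A' A''" "g3 \<in> monoid_iso B' B''"
    and gc: "\<forall>x\<in>carrier X'. g2 (k' x) = k'' (g1 x)" "\<forall>a\<in>carrier A'. p'' (g2 a) = g3 (p' a)"
      "\<forall>b\<in>carrier B'. g2 (s' b) = s'' (g3 b)" "\<forall>a\<in>carrier A'. q'' (g2 a) = g1 (q' a)"
    using assms(3) unfolding S' S'' by auto
  note cl = f[THEN monoid_isoD(1), THEN monoid_homD(1)]
  show ?thesis
    unfolding S S'' semibiproduct_isomorphic.simps
    by (rule exI[of _ "g1 \<circ> f1"], rule exI[of _ "g2 \<circ> f2"], rule exI[of _ "g3 \<circ> f3"])
      (simp add: monoid_iso_comp[OF f(1) g(1)] monoid_iso_comp[OF f(2) g(2)]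
        monoid_iso_comp[OF f(3) g(3)] fc gc cl)
qed

lemma semibiproduct_isomorphic_sym:
  assumes "semibiproduct S" "semibiproduct S'" "semibiproduct_isomorphic S S'"
  shows "semibiproduct_isomorphic S' S"
proof -
  obtain X A B p k q s where S: "S = (X, A, B, p, k, q, s)" by (cases S)
  obtain X' A' B' p' k' q' s' where S': "S' = (X', A', B', p', k', q', s')" by (cases S')
  interpret S: pointed_semibiproduct X A B p k q s using assms(1) by (simp add: S semibiproduct_def)
  interpret S': pointed_semibiproduct X' A' B' p' k' q' s'
    using assms(2) by (simp add: S' semibiproduct_def)
  obtain f1 f2 f3 where f: "f1 \<in> monoid_iso X X'" "f2 \<in> monoid_iso A A'" "f3 \<in> monoid_iso B B'"
    and fc: "\<forall>x\<in>carrier X. f2 (k x) = k' (f1 x)" "\<forall>a\<in>carrier A. p' (f2 a) = f3 (p a)"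
      "\<forall>b\<in>carrier B. f2 (s b) = s' (f3 b)" "\<forall>a\<in>carrier A. q' (f2 a) = f1 (q a)"
    using assms(3) unfolding S S' by auto
  define g1 where "g1 = inv_into (carrier X) f1"
  define g2 where "g2 = inv_into (carrier A) f2"
  define g3 where "g3 = inv_into (carrier B) f3"
  note g1 = monoid_iso_inverse[OF f(1) S.X.monoid_axioms, folded g1_def]
  note g2 = monoid_iso_inverse[OF f(2) S.A.monoid_axioms, folded g2_def]
  note g3 = monoid_iso_inverse[OF f(3) S.B.monoid_axioms, folded g3_def]
  \<comment> \<open>Each equation for the inverses is the original one at a preimage, with the
    inverse of the outer map applied to both sides.\<close>
  have "g2 (k' x) = k (g1 x)" if "x \<in> carrier X'" for x
    using fc(1)[rule_format, of "g1 x"] g1 g2(2)[of "k (g1 x)"] that by simp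
  moreover have "p (g2 a) = g3 (p' a)" if "a \<in> carrier A'" for a
    using fc(2)[rule_format, of "g2 a"] g2 g3(2)[of "p (g2 a)"] that by simp
  moreover have "g2 (s' b) = s (g3 b)" if "b \<in> carrier B'" for b
    using fc(3)[rule_format, of "g3 b"] g3 g2(2)[of "s (g3 b)"] that by simp
  moreover have "q (g2 a) = g1 (q' a)" if "a \<in> carrier A'" for a
    using fc(4)[rule_format, of "g2 a"] g2 g1(2)[of "q (g2 a)"] that by simp
  ultimately show ?thesis
    unfolding S S' semibiproduct_isomorphic.simps using g1(1) g2(1) g3(1) by blast
qed

text \<open>Transport of structure along three isomorphisms. It serves to replace \<open>X\<close>
  and \<open>B\<close> by \<open>monM\<close> or \<open>grpG\<close>, and to move a semibiproduct
  built over \<open>two\<close> into arbitrary types.\<close>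

lemma relabelled_semibiproduct:
  assumes "pointed_semibiproduct X A B p k q s" "monoid X'" "monoid A'" "monoid B'"
    and f1: "f1 \<in> monoid_iso X X'" and f2: "f2 \<in> monoid_iso A A'" and f3: "f3 \<in> monoid_iso B B'"
  defines "g1 \<equiv> inv_into (carrier X) f1" and "g2 \<equiv> inv_into (carrier A) f2"
    and "g3 \<equiv> inv_into (carrier B) f3"
  shows "pointed_semibiproduct X' A' B' (f3 \<circ> p \<circ> g2) (f2 \<circ> k \<circ> g1) (f1 \<circ> q \<circ> g2) (f2 \<circ> s \<circ> g3)"
    and "semibiproduct_isomorphic (X, A, B, p, k, q, s)
      (X', A', B', f3 \<circ> p \<circ> g2, f2 \<circ> k \<circ> g1, f1 \<circ> q \<circ> g2, f2 \<circ> s \<circ> g3)"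
proof -
  interpret pointed_semibiproduct X A B p k q s by fact
  interpret X': monoid X' by fact
  interpret A': monoid A' by fact
  interpret B': monoid B' by fact
  note g1 = monoid_iso_inverse[OF f1 X.monoid_axioms, folded g1_def]
  note g2 = monoid_iso_inverse[OF f2 A.monoid_axioms, folded g2_def]
  note g3 = monoid_iso_inverse[OF f3 B.monoid_axioms, folded g3_def]
  note h1 = monoid_homD[OF monoid_isoD(1)[OF f1]] and h2 = monoid_homD[OF monoid_isoD(1)[OF f2]]
    and h3 = monoid_homD[OF monoid_isoD(1)[OF f3]]
  note k1 = monoid_homD[OF monoid_isoD(1)[OF g1(1)]] and k2 = monoid_homD[OF monoid_isoD(1)[OF g2(1)]]
    and k3 = monoid_homD[OF monoid_isoD(1)[OF g3(1)]]
  show "pointed_semibiproduct X' A' B' (f3 \<circ> p \<circ> g2) (f2 \<circ> k \<circ> g1) (f1 \<circ> q \<circ> g2) (f2 \<circ> s \<circ> g3)"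
  proof unfold_locales
    show "(f2 \<circ> k \<circ> g1) ((f1 \<circ> q \<circ> g2) a) \<otimes>\<^bsub>A'\<^esub> (f2 \<circ> s \<circ> g3) ((f3 \<circ> p \<circ> g2) a) = a"
      if "a \<in> carrier A'" for a
      using that h2(2)[of "k (q (g2 a))" "s (p (g2 a))"] by (simp add: g1 g2 g3 decomp)
    show "f3 \<circ> p \<circ> g2 \<in> monoid_hom A' B'"
      by (rule monoid_homI) (simp_all add: g2 h3 k2 p_mult)
    show "f2 \<circ> k \<circ> g1 \<in> monoid_hom X' A'"
      by (rule monoid_homI) (simp_all add: g1 h2 k1 k_mult)
  qed (auto simp: pointed_map_def g1 g2 g3 h1 h2 h3 k2 k3 ps qk pk qs)
  show "semibiproduct_isomorphic (X, A, B, p, k, q, s)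
      (X', A', B', f3 \<circ> p \<circ> g2, f2 \<circ> k \<circ> g1, f1 \<circ> q \<circ> g2, f2 \<circ> s \<circ> g3)"
    unfolding semibiproduct_isomorphic.simps
    by (rule exI[of _ f1], rule exI[of _ f2], rule exI[of _ f3]) (simp add: f1 f2 f3 g1 g2 g3)
qed

text \<open>By \<open>q_mult\<close> the coordinates of a product depend only on the coordinates of
  the factors and on the shared operations. Hence matching elements with equal coordinates is an
  isomorphism of \<open>A\<close> with \<open>A'\<close>, with identities on \<open>X\<close> and
  \<open>B\<close>.\<close>

lemma isomorphic_if_same_action_system:
  assumes "pointed_semibiproduct X A B p k q s" "pointed_semibiproduct X A' B p' k' q' s'"
    and sys: "system_of (X, A, B, p, k, q, s) = system_of (X, A', B, p', k', q', s')"
  shows "semibiproduct_isomorphic (X, A, B, p, k, q, s) (X, A', B, p', k', q', s')"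
proof -
  interpret S: pointed_semibiproduct X A B p k q s by fact
  interpret S': pointed_semibiproduct X A' B p' k' q' s' by fact
  have ops: "S'.rho = S.rho" "S'.phi = S.phi" "S'.gam = S.gam"
    using sys unfolding S.system_of_eq S'.system_of_eq by simp_all
  \<comment> \<open>The candidate in \<open>A'\<close> for the element with the coordinates of
    \<open>a\<close>; \<open>g\<close> goes back in the same way.\<close>
  define f where "f a = k' (q a) \<otimes>\<^bsub>A'\<^esub> s' (p a)" for a
  define g where "g a = k (q' a) \<otimes>\<^bsub>A\<^esub> s (p' a)" for a
  have cl: "f a \<in> carrier A'" if "a \<in> carrier A" for a
    using that by (simp add: f_def)
  have p_f: "p' (f a) = p a" if "a \<in> carrier A" for a
    using that by (simp add: f_def S'.p_mult S'.pk S'.ps)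
  \<comment> \<open>Here the equality of systems enters: the pair \<open>q a\<close>,
    \<open>p a\<close> is fixed by \<open>rho\<close> on one side, hence on the other.\<close>
  have q_f: "q' (f a) = q a" if "a \<in> carrier A" for a
    using S.rho_q_p[OF that] unfolding ops[symmetric] S'.rho_def f_def .
  have cl': "g a \<in> carrier A" if "a \<in> carrier A'" for a
    using that by (simp add: g_def)
  have p_g: "p (g a) = p' a" if "a \<in> carrier A'" for a
    using that by (simp add: g_def S.p_mult S.pk S.ps)
  have q_g: "q (g a) = q' a" if "a \<in> carrier A'" for a
    using S'.rho_q_p[OF that] unfolding ops S.rho_def g_def .
  have gf: "g (f a) = a" if "a \<in> carrier A" for a
    using S.eq_iff_q_p[of "g (f a)" a] that by (simp add: cl cl' p_f q_f p_g q_g)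
  have fg: "f (g a) = a" if "a \<in> carrier A'" for a
    using S'.eq_iff_q_p[of "f (g a)" a] that by (simp add: cl cl' p_f q_f p_g q_g)
  have "f (a \<otimes>\<^bsub>A\<^esub> a') = f a \<otimes>\<^bsub>A'\<^esub> f a'" if "a \<in> carrier A" "a' \<in> carrier A" for a a'
    using S'.eq_iff_q_p[of "f (a \<otimes>\<^bsub>A\<^esub> a')" "f a \<otimes>\<^bsub>A'\<^esub> f a'"] that
    by (simp add: cl p_f q_f S.p_mult S'.p_mult S.q_mult S'.q_mult ops)
  moreover have "bij_betw f (carrier A) (carrier A')"
    by (rule bij_betw_byWitness[of _ g]) (auto simp: gf fg cl cl')
  ultimately have "f \<in> monoid_iso A A'"
    using cl by (auto simp: monoid_iso_def f_def intro!: monoid_homI)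
  moreover have "f (k x) = k' x" if "x \<in> carrier X" for x
    using that by (simp add: f_def S.qk S.pk)
  moreover have "f (s b) = s' b" if "b \<in> carrier B" for b
    using that by (simp add: f_def S.qs S.ps)
  ultimately show ?thesis
    unfolding semibiproduct_isomorphic.simps
    by (intro exI[of _ id] exI[of _ f]) (simp add: monoid_iso_id p_f q_f)
qed

section \<open>Classification\<close>

lemma mem_two_element_semibiproducts:
  "(X, A, B, p, k, q, s) \<in> two_element_semibiproducts \<longleftrightarrow>
    pointed_semibiproduct X A B p k q s \<and> card (carrier X) = 2 \<and> card (carrier B) = 2"
  by (simp add: two_element_semibiproducts_def)

lemma semibiproduct_two_element: "S \<in> two_element_semibiproducts \<Longrightarrow> semibiproduct S"
  by (auto simp: two_element_semibiproducts_def semibiproduct_def)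

text \<open>The identifications for \<open>S'\<close> are those for \<open>S\<close> followed by
  \<open>f1\<close> and \<open>f3\<close>. So the matrices of \<open>S'\<close> are those of
  \<open>S\<close> with \<open>f1\<close> applied to each value and then cancelled.\<close>

lemma classifying_system_eq_if_isomorphic:
  assumes "S \<in> two_element_semibiproducts" "semibiproduct_isomorphic S S'"
  shows "classifying_system S = classifying_system S'"
proof -
  obtain X A B p k q s where S: "S = (X, A, B, p, k, q, s)" by (cases S)
  obtain X' A' B' p' k' q' s' where S': "S' = (X', A', B', p', k', q', s')" by (cases S')
  interpret pointed_semibiproduct X A B p k q s
    using assms(1) by (simp add: S mem_two_element_semibiproducts)
  have card: "card (carrier X) = 2" "card (carrier B) = 2"
    using assms(1) by (simp_all add: S mem_two_element_semibiproducts)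
  obtain f1 f2 f3 where f: "f1 \<in> monoid_iso X X'" "f2 \<in> monoid_iso A A'" "f3 \<in> monoid_iso B B'"
    and fc: "\<forall>x\<in>carrier X. f2 (k x) = k' (f1 x)" "\<forall>a\<in>carrier A. p' (f2 a) = f3 (p a)"
      "\<forall>b\<in>carrier B. f2 (s b) = s' (f3 b)" "\<forall>a\<in>carrier A. q' (f2 a) = f1 (q a)"
    using assms(2) unfolding S S' by auto
  obtain N u where N: "N \<in> {monM, grpG}" and u: "u \<in> monoid_iso N X"
    and idX: "identification X = (N, u)" "identification X' = (N, f1 \<circ> u)"
    using obtain_identification[OF X.monoid_axioms card(1)] f(1) by metis
  obtain P v where P: "P \<in> {monM, grpG}" and v: "v \<in> monoid_iso P B"
    and idB: "identification B = (P, v)" "identification B' = (P, f3 \<circ> v)"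
    using obtain_identification[OF B.monoid_axioms card(2)] f(3) by metis
  have uv [simp]: "u i \<in> carrier X" "v i \<in> carrier B" for i
    using monoid_homD(1)[OF monoid_isoD(1)[OF u]] monoid_homD(1)[OF monoid_isoD(1)[OF v]]
      carrier_standard[OF N] carrier_standard[OF P] by auto
  note hf = monoid_homD[OF monoid_isoD(1)[OF f(2)]]
  have inj: "inj u" "inj_on f1 (carrier X)" and ran: "range u = carrier X"
    using monoid_isoD(2)[OF u] monoid_isoD(2)[OF f(1)] carrier_standard[OF N]
    by (auto simp: bij_betw_def)
  have "inv_into UNIV (f1 \<circ> u) (f1 x) = inv_into UNIV u x" if x: "x \<in> carrier X" for x
  proof -
    obtain i where "x = u i" using x ran by auto
    moreover have "inj (f1 \<circ> u)" using inj ran by (simp add: comp_inj_on)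
    ultimately show ?thesis using inj(1) by (metis comp_apply inv_f_f)
  qed
  \<comment> \<open>All three operations are \<open>q\<close> of a product in \<open>A\<close>, so
    this one equation covers them.\<close>
  moreover have "q' (f2 a \<otimes>\<^bsub>A'\<^esub> f2 a') = f1 (q (a \<otimes>\<^bsub>A\<^esub> a'))"
    if "a \<in> carrier A" "a' \<in> carrier A" for a a'
    using that fc(4) by (simp flip: hf(2))
  ultimately show ?thesis
    by (simp add: S S' classifying_system_def idX idB flip: fc(1,3))
qed

text \<open>The identification of a standard monoid is the identity, so transport changes
  nothing.\<close>

lemma classifying_system_standard:
  assumes "N \<in> {monM, grpG}" "P \<in> {monM, grpG}"
  shows "classifying_system (N, A, P, p, k, q, s) = system_of (N, A, P, p, k, q, s)"
  using assms by (simp add: classifying_system_def identification_standard)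

lemma card_UNIV_two: "card (UNIV :: two set) = 2"
  by (simp add: UNIV_two)

lemma obtain_standard_semibiproduct:
  fixes S :: "('x, 'a, 'b) semibiproduct_data"
  assumes "S \<in> two_element_semibiproducts"
  obtains N A P p k q s where "N \<in> {monM, grpG}" "P \<in> {monM, grpG}"
    "pointed_semibiproduct N (A :: 'a monoid) P p k q s"
    "semibiproduct_isomorphic S (N, A, P, p, k, q, s)"
    "classifying_system S = system_of (N, A, P, p, k, q, s)"
proof -
  obtain X A B p k q s where S: "S = (X, A, B, p, k, q, s)" by (cases S)
  interpret pointed_semibiproduct X A B p k q s
    using assms by (simp add: S mem_two_element_semibiproducts)
  have card: "card (carrier X) = 2" "card (carrier B) = 2"
    using assms by (simp_all add: S mem_two_element_semibiproducts)
  obtain N u where N: "N \<in> {monM, grpG}" and u: "u \<in> monoid_iso N X"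
    using obtain_identification[OF X.monoid_axioms card(1)] by metis
  obtain P v where P: "P \<in> {monM, grpG}" and v: "v \<in> monoid_iso P B"
    using obtain_identification[OF B.monoid_axioms card(2)] by metis
  \<comment> \<open>The identifications point from the standard monoids to \<open>X\<close> and
    \<open>B\<close>, so their inverses are used; \<open>A\<close> is kept.\<close>
  note T = relabelled_semibiproduct[OF pointed_semibiproduct_axioms monoid_standard[OF N]
      A.monoid_axioms monoid_standard[OF P] monoid_iso_inverse(1)[OF u monoid_standard[OF N]]
      monoid_iso_id monoid_iso_inverse(1)[OF v monoid_standard[OF P]]]
  show thesis
    by (rule that[OF N P T[folded S]])
      (simp only: classifying_system_eq_if_isomorphic[OF assms T(2)[folded S]]
        classifying_system_standard[OF N P])
qed

lemma classifying_system_mem: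
  fixes S :: "('x, 'a, 'b) semibiproduct_data"
  assumes "S \<in> two_element_semibiproducts"
  shows "classifying_system S \<in> fourteen_systems"
proof -
  obtain N and A :: "'a monoid" and P p k q s
    where N: "N \<in> {monM, grpG}" and P: "P \<in> {monM, grpG}"
    and T: "pointed_semibiproduct N A P p k q s"
    and "semibiproduct_isomorphic S (N, A, P, p, k, q, s)"
    and cl: "classifying_system S = system_of (N, A, P, p, k, q, s)"
    by (rule obtain_standard_semibiproduct[OF assms])
  interpret pointed_semibiproduct N A P p k q s by fact
  show ?thesis
    unfolding cl system_of_eq action_systems_eq_fourteen_systems[symmetric]
    using N P action_system by simp
qed

lemma isomorphic_iff_classifying_system_eq:
  fixes S :: "('x, 'a, 'b) semibiproduct_data" and S' :: "('y, 'c, 'd) semibiproduct_data"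
  assumes "S \<in> two_element_semibiproducts" "S' \<in> two_element_semibiproducts"
  shows "semibiproduct_isomorphic S S' \<longleftrightarrow> classifying_system S = classifying_system S'"
proof
  assume eq: "classifying_system S = classifying_system S'"
  obtain N and A :: "'a monoid" and P p k q s where "N \<in> {monM, grpG}" "P \<in> {monM, grpG}"
    and T: "pointed_semibiproduct N A P p k q s"
    and iso: "semibiproduct_isomorphic S (N, A, P, p, k, q, s)"
    and cl: "classifying_system S = system_of (N, A, P, p, k, q, s)"
    by (rule obtain_standard_semibiproduct[OF assms(1)])
  obtain N' and A' :: "'c monoid" and P' p' k' q' s'
    where "N' \<in> {monM, grpG}" "P' \<in> {monM, grpG}"
    and T': "pointed_semibiproduct N' A' P' p' k' q' s'"
    and iso': "semibiproduct_isomorphic S' (N', A', P', p', k', q', s')"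
    and cl': "classifying_system S' = system_of (N', A', P', p', k', q', s')"
    by (rule obtain_standard_semibiproduct[OF assms(2)])
  have sys: "system_of (N, A, P, p, k, q, s) = system_of (N', A', P', p', k', q', s')"
    using eq cl cl' by simp
  \<comment> \<open>A system contains its two monoids as components, so equal systems lie over the
    same \<open>N\<close> and \<open>P\<close>.\<close>
  then have NP: "N' = N" "P' = P" by simp_all
  have T_T': "semibiproduct_isomorphic (N, A, P, p, k, q, s) (N', A', P', p', k', q', s')"
    using isomorphic_if_same_action_system[OF T T'[unfolded NP] sys[unfolded NP]] unfolding NP .
  have sb: "semibiproduct (N, A, P, p, k, q, s)" "semibiproduct (N', A', P', p', k', q', s')"
    using T T' by (simp_all add: semibiproduct_def)
  note iso'' = semibiproduct_isomorphic_sym[OF semibiproduct_two_element[OF assms(2)] sb(2) iso']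
  show "semibiproduct_isomorphic S S'"
    by (rule semibiproduct_isomorphic_trans[OF semibiproduct_two_element[OF assms(1)] iso
          semibiproduct_isomorphic_trans[OF sb(1) T_T' iso'']])
qed (rule classifying_system_eq_if_isomorphic[OF assms(1)])

section \<open>Realizing an action system\<close>

text \<open>A copy of \<open>A\<close> inside another type, needed to realize systems over arbitrary
  carrier types.\<close>

definition image_monoid :: "('a \<Rightarrow> 'c) \<Rightarrow> 'a monoid \<Rightarrow> 'c monoid" where
  "image_monoid j A = \<lparr>carrier = j ` carrier A,
     mult = (\<lambda>c d. j (inv_into (carrier A) j c \<otimes>\<^bsub>A\<^esub> inv_into (carrier A) j d)), one = j \<one>\<^bsub>A\<^esub>\<rparr>"

lemma image_monoid:
  assumes "monoid A" "inj_on j (carrier A)"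
  shows "monoid (image_monoid j A)" "j \<in> monoid_iso A (image_monoid j A)"
    "card (carrier (image_monoid j A)) = card (carrier A)"
proof -
  interpret A: monoid A by fact
  show "monoid (image_monoid j A)"
    by (rule monoidI) (use assms(2) in \<open>auto simp: image_monoid_def A.m_assoc\<close>)
  show "j \<in> monoid_iso A (image_monoid j A)"
    using assms(2) by (auto simp: image_monoid_def monoid_iso_def bij_betw_def intro!: monoid_homI)
  show "card (carrier (image_monoid j A)) = card (carrier A)"
    using assms(2) by (simp add: image_monoid_def card_image)
qed

section \<open>The semibiproduct built from an action system\<close>

context pointed_monoid_action_system
begin

text \<open>The product is the formula of \<open>q_mult\<close>. When \<rho>(x, b) = x and \<gamma>
  is trivial, this is the semidirect product.\<close>

definition total_monoid :: "('x \<times> 'b) monoid" where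
  "total_monoid = \<lparr>carrier = {(x, b). x \<in> carrier X \<and> b \<in> carrier B \<and> \<rho> x b = x},
     mult = (\<lambda>(x, b) (x', b'). (\<rho> (x \<otimes>\<^bsub>X\<^esub> \<phi> b x' \<otimes>\<^bsub>X\<^esub> \<gamma> b b') (b \<otimes>\<^bsub>B\<^esub> b'), b \<otimes>\<^bsub>B\<^esub> b')),
     one = (\<one>\<^bsub>X\<^esub>, \<one>\<^bsub>B\<^esub>)\<rparr>"

lemma operations_closed [simp, intro]:
  "\<lbrakk>x \<in> carrier X; b \<in> carrier B\<rbrakk> \<Longrightarrow> \<rho> x b \<in> carrier X"
  "\<lbrakk>x \<in> carrier X; b \<in> carrier B\<rbrakk> \<Longrightarrow> \<phi> b x \<in> carrier X"
  "\<lbrakk>b \<in> carrier B; b' \<in> carrier B\<rbrakk> \<Longrightarrow> \<gamma> b b' \<in> carrier X"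
  using rho_closed phi_closed gamma_closed by auto

text \<open>\<open>rho_rho\<close> keeps products among the fixed pairs, and
  \<open>main_identity\<close> is associativity in the first component. A product with the unit
  reduces to \<open>\<rho> x b\<close>, which is \<open>x\<close> on fixed pairs.\<close>

lemma monoid_total_monoid: "monoid total_monoid"
proof (rule monoidI)
  fix a b c
  assume "a \<in> carrier total_monoid" "b \<in> carrier total_monoid" "c \<in> carrier total_monoid"
  then show "a \<otimes>\<^bsub>total_monoid\<^esub> b \<otimes>\<^bsub>total_monoid\<^esub> c = a \<otimes>\<^bsub>total_monoid\<^esub> (b \<otimes>\<^bsub>total_monoid\<^esub> c)"
    using main_identity by (auto simp: total_monoid_def B.m_assoc)
qed (auto simp: total_monoid_def rho_rho[symmetric] rho_one_right rho_one_left
    phi_one_left phi_one_right gamma_one_left gamma_one_right)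

text \<open>The pointedness of \<open>\<rho>\<close> makes the pairs with a unit component fixed.
  The product of \<open>(x, 1)\<close> and \<open>(1, b)\<close> is \<open>(\<rho> x b, b)\<close>,
  which is \<open>(x, b)\<close> on the carrier.\<close>

lemma total_semibiproduct:
  "pointed_semibiproduct X total_monoid B snd (\<lambda>x. (x, \<one>\<^bsub>B\<^esub>)) fst (\<lambda>b. (\<one>\<^bsub>X\<^esub>, b))"
proof -
  interpret A: monoid total_monoid by (rule monoid_total_monoid)
  show ?thesis
    by unfold_locales
      (auto intro!: monoid_homI simp: pointed_map_def total_monoid_def rho_one_right rho_one_left
        phi_one_left phi_one_right gamma_one_left gamma_one_right)
qed

text \<open>The products give \<open>\<phi>\<close> and \<open>\<gamma>\<close> with an outer
  \<open>\<rho>\<close>; the axioms \<open>phi_rho\<close> and \<open>gamma_rho\<close> remove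
  it.\<close>

lemma system_of_total_semibiproduct:
  assumes "x \<in> carrier X" "x' \<in> carrier X" "b \<in> carrier B" "b' \<in> carrier B"
  shows "fst ((x, \<one>\<^bsub>B\<^esub>) \<otimes>\<^bsub>total_monoid\<^esub> (\<one>\<^bsub>X\<^esub>, b)) = \<rho> x b"
    "fst ((\<one>\<^bsub>X\<^esub>, b) \<otimes>\<^bsub>total_monoid\<^esub> (x, \<one>\<^bsub>B\<^esub>)) = \<phi> b x"
    "fst ((\<one>\<^bsub>X\<^esub>, b) \<otimes>\<^bsub>total_monoid\<^esub> (\<one>\<^bsub>X\<^esub>, b')) = \<gamma> b b'"
  using assms by (simp_all add: total_monoid_def rho_one_right rho_one_left phi_one_left
      phi_one_right gamma_one_left gamma_one_right phi_rho[symmetric] gamma_rho[symmetric])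

end

section \<open>Embedding into arbitrary carrier types\<close>

lemma inj_two_into:
  assumes "card (U :: 'c set) = 2"
  obtains j :: "two \<Rightarrow> 'c" where "inj j"
proof -
  have "finite U" using assms by (metis card.infinite zero_neq_numeral)
  then obtain j :: "two \<Rightarrow> 'c" where "inj_on j UNIV"
    using card_le_inj[of "UNIV :: two set" U] assms by (auto simp: UNIV_two)
  then show thesis by (rule that)
qed

text \<open>The premise says that the type has at least four elements, enough room for
  \<open>total_monoid\<close> over \<open>two\<close>.\<close>

lemma inj_two_times_two_into:
  assumes "card (U :: 'c set) = 4"
  obtains j :: "two \<times> two \<Rightarrow> 'c" where "inj j"
proof -
  have "finite U" using assms by (metis card.infinite zero_neq_numeral)
  moreover have "card (UNIV :: (two \<times> two) set) = 4" "finite (UNIV :: (two \<times> two) set)"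
    by (simp_all add: UNIV_two flip: UNIV_Times_UNIV)
  ultimately obtain j :: "two \<times> two \<Rightarrow> 'c" where "inj_on j UNIV"
    using card_le_inj[of "UNIV :: (two \<times> two) set" U] assms by auto
  then show thesis by (rule that)
qed

text \<open>The total semibiproduct over \<open>two\<close> has the given system. Relabelling along
  injections into the required types leaves the classifying system unchanged.\<close>

lemma classifying_system_surj:
  assumes "\<exists>U :: 'x set. card U = 2" "\<exists>U :: 'a set. card U = 4" "\<exists>U :: 'b set. card U = 2"
    and "\<Sigma> \<in> fourteen_systems"
  shows "\<exists>S \<in> (two_element_semibiproducts :: ('x, 'a, 'b) semibiproduct_data set).
    classifying_system S = \<Sigma>"
proof -
  obtain X B \<rho> \<phi> \<gamma> where \<Sigma>: "\<Sigma> = (X, B, \<rho>, \<phi>, \<gamma>)" by (cases \<Sigma>)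
  have X: "X \<in> {monM, grpG}" and B: "B \<in> {monM, grpG}"
    and sys: "pointed_monoid_action_system X B \<rho> \<phi> \<gamma>"
    using assms(4) unfolding \<Sigma> action_systems_eq_fourteen_systems[symmetric] by simp_all
  interpret pointed_monoid_action_system X B \<rho> \<phi> \<gamma> by fact
  obtain j1 :: "two \<Rightarrow> 'x" where j1: "inj j1" using inj_two_into assms(1) by metis
  obtain j2 :: "two \<times> two \<Rightarrow> 'a" where j2: "inj j2" using inj_two_times_two_into assms(2) by metis
  obtain j3 :: "two \<Rightarrow> 'b" where j3: "inj j3" using inj_two_into assms(3) by metis
  let ?T = "(X, total_monoid, B, snd, \<lambda>x. (x, \<one>\<^bsub>B\<^esub>), fst, \<lambda>b. (\<one>\<^bsub>X\<^esub>, b))"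
  have T: "?T \<in> two_element_semibiproducts"
    using total_semibiproduct
    by (simp add: mem_two_element_semibiproducts carrier_standard[OF X] carrier_standard[OF B]
        card_UNIV_two)
  note i1 = image_monoid[OF X.monoid_axioms inj_on_subset[OF j1 subset_UNIV]]
    and i2 = image_monoid[OF monoid_total_monoid inj_on_subset[OF j2 subset_UNIV]]
    and i3 = image_monoid[OF B.monoid_axioms inj_on_subset[OF j3 subset_UNIV]]
  note S = relabelled_semibiproduct[OF total_semibiproduct i1(1) i2(1) i3(1) i1(2) i2(2) i3(2)]
  have "classifying_system ?T = \<Sigma>"
    using system_of_total_semibiproduct carrier_standard[OF X] carrier_standard[OF B]
    unfolding classifying_system_standard[OF X B] \<Sigma> by (simp add: fun_eq_iff)
  then have "\<Sigma> = classifying_system (image_monoid j1 X, image_monoid j2 total_monoid, image_monoid j3 B,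
      j3 \<circ> snd \<circ> inv_into (carrier total_monoid) j2,
      j2 \<circ> (\<lambda>x. (x, \<one>\<^bsub>B\<^esub>)) \<circ> inv_into (carrier X) j1,
      j1 \<circ> fst \<circ> inv_into (carrier total_monoid) j2,
      j2 \<circ> (\<lambda>b. (\<one>\<^bsub>X\<^esub>, b)) \<circ> inv_into (carrier B) j3)" (is "_ = classifying_system ?S")
    using classifying_system_eq_if_isomorphic[OF T S(2)] by simp
  moreover have "?S \<in> two_element_semibiproducts"
    using S(1) i1(3) i3(3)
    by (simp add: mem_two_element_semibiproducts carrier_standard[OF X] carrier_standard[OF B]
        card_UNIV_two)
  ultimately show ?thesis by metis
qed

text \<open>Isomorphism is the kernel of \<open>classifying_system\<close>, which makes the
  equivalence laws and compatibility immediate.\<close>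

lemma semibiproduct_iso_rel_eq:
  "semibiproduct_iso_rel = {(S, S'). S \<in> two_element_semibiproducts
     \<and> S' \<in> two_element_semibiproducts \<and> classifying_system S = classifying_system S'}"
  unfolding semibiproduct_iso_rel_def using isomorphic_iff_classifying_system_eq by blast

lemma equiv_semibiproduct_iso_rel: "equiv two_element_semibiproducts semibiproduct_iso_rel"
  unfolding semibiproduct_iso_rel_eq
  by (rule equivI, blast)
    (simp_all only: refl_on_def sym_def trans_def mem_Collect_eq prod.case, metis+)

lemma bij_betw_classifying_system:
  assumes "\<exists>U :: 'x set. card U = 2" "\<exists>U :: 'a set. card U = 4" "\<exists>U :: 'b set. card U = 2"
  shows "bij_betw (\<lambda>C. the_elem (classifying_system ` C))
    ((two_element_semibiproducts :: ('x, 'a, 'b) semibiproduct_data set) // semibiproduct_iso_rel)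
    fourteen_systems"
proof -
  let ?D = "two_element_semibiproducts :: ('x, 'a, 'b) semibiproduct_data set"
  let ?h = "\<lambda>C :: ('x, 'a, 'b) semibiproduct_data set. the_elem (classifying_system ` C)"
  \<comment> \<open>Each class is a fibre of \<open>classifying_system\<close>, so its image is a
    singleton and \<open>the_elem\<close> returns the common value.\<close>
  have class_eq: "semibiproduct_iso_rel `` {S} = {S' \<in> ?D. classifying_system S' = classifying_system S}"
    if "S \<in> ?D" for S
    using that unfolding semibiproduct_iso_rel_eq by auto
  have h: "?h (semibiproduct_iso_rel `` {S}) = classifying_system S" if "S \<in> ?D" for S
  proof -
    have "classifying_system ` (semibiproduct_iso_rel `` {S}) = {classifying_system S}"
      using that by (auto simp: class_eq)
    then show ?thesis by simp
  qed
  have "inj_on ?h (?D // semibiproduct_iso_rel)"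
  proof (rule inj_onI)
    fix C C' assume "C \<in> ?D // semibiproduct_iso_rel" "C' \<in> ?D // semibiproduct_iso_rel"
    then obtain S S' where S: "S \<in> ?D" "C = semibiproduct_iso_rel `` {S}"
      and S': "S' \<in> ?D" "C' = semibiproduct_iso_rel `` {S'}"
      by (meson quotientE)
    assume "?h C = ?h C'"
    then have "classifying_system S = classifying_system S'"
      using S S' h by metis
    then show "C = C'" by (simp only: S S' class_eq)
  qed
  moreover have "?h ` (?D // semibiproduct_iso_rel) = classifying_system ` ?D"
    unfolding quotient_def by (auto simp: h image_iff)
  moreover have "classifying_system ` ?D = fourteen_systems"
    using classifying_system_mem classifying_system_surj[OF assms]
    by (intro subset_antisym image_subsetI subsetI) (blast, metis image_eqI)
  ultimately show ?thesis by (simp add: bij_betw_def)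
qed

text \<open>Classes are formed over fixed carrier types; the cardinality premises give room for
  \<open>X\<close>, \<open>A\<close> and \<open>B\<close>, where the largest \<open>A\<close> has
  four elements. Comparing isomorphism with equality of systems across different types shows that
  the classification does not depend on the types chosen.\<close>

theorem mainTheorem2:
  shows
    "{(X, B, \<rho>, \<phi>, \<gamma>). X \<in> {monM, grpG} \<and> B \<in> {monM, grpG}
        \<and> pointed_monoid_action_system X B \<rho> \<phi> \<gamma>} = fourteen_systems
     \<and> card fourteen_systems = 14
     \<and> (\<forall>X :: 'x monoid. monoid X \<and> card (carrier X) = 2 \<longrightarrow> (\<exists>!Nu. Nu \<in> identifications X))
     \<and> (\<forall>S \<in> (two_element_semibiproducts :: ('x, 'a, 'b) semibiproduct_data set).
          classifying_system S \<in> fourteen_systems)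
     \<and> (\<forall>S \<in> (two_element_semibiproducts :: ('x, 'a, 'b) semibiproduct_data set).
        \<forall>S' \<in> (two_element_semibiproducts :: ('y, 'c, 'd) semibiproduct_data set).
          semibiproduct_isomorphic S S' \<longleftrightarrow> classifying_system S = classifying_system S')
     \<and> equiv (two_element_semibiproducts :: ('x, 'a, 'b) semibiproduct_data set)
          semibiproduct_iso_rel
     \<and> classifying_system respects
          (semibiproduct_iso_rel ::
            (('x, 'a, 'b) semibiproduct_data \<times> ('x, 'a, 'b) semibiproduct_data) set)
     \<and> ((\<exists>U :: 'x set. card U = 2) \<and> (\<exists>U :: 'a set. card U = 4) \<and> (\<exists>U :: 'b set. card U = 2) \<longrightarrow>
          bij_betw (\<lambda>C. the_elem (classifying_system ` C))
            ((two_element_semibiproducts :: ('x, 'a, 'b) semibiproduct_data set)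
               // semibiproduct_iso_rel)
            fourteen_systems
          \<and> card ((two_element_semibiproducts :: ('x, 'a, 'b) semibiproduct_data set)
                    // semibiproduct_iso_rel) = 14)"
proof (intro conjI impI ballI allI)
  show "\<exists>!Nu. Nu \<in> identifications X" if "monoid X \<and> card (carrier X) = 2" for X :: "'x monoid"
    using that two_element_monoid_has_identification[of X] identification_unique[of _ _ X]
    by (metis surj_pair)
  show "classifying_system respects (semibiproduct_iso_rel ::
      (('x, 'a, 'b) semibiproduct_data \<times> ('x, 'a, 'b) semibiproduct_data) set)"
    unfolding semibiproduct_iso_rel_eq by (rule congruentI) blast
  assume "(\<exists>U :: 'x set. card U = 2) \<and> (\<exists>U :: 'a set. card U = 4) \<and> (\<exists>U :: 'b set. card U = 2)"
  then show bij: "bij_betw (\<lambda>C. the_elem (classifying_system ` C))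
      ((two_element_semibiproducts :: ('x, 'a, 'b) semibiproduct_data set) // semibiproduct_iso_rel)
      fourteen_systems"
    by (intro bij_betw_classifying_system) simp_all
  show "card ((two_element_semibiproducts :: ('x, 'a, 'b) semibiproduct_data set)
      // semibiproduct_iso_rel) = 14"
    using bij_betw_same_card[OF bij] by (simp add: card_fourteen_systems)
qed (simp_all only: action_systems_eq_fourteen_systems card_fourteen_systems classifying_system_mem
    isomorphic_iff_classifying_system_eq equiv_semibiproduct_iso_rel)

end
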